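(* Let $\mu$ be an uncountable regular cardinal, let $\lambda=\mu^+$, and let $S\subseteq S^\lambda_\mu$ be stationary in $\lambda$. Then there is an $S$-club sequence $\underline{C}=\langle C_\delta:\delta\in S\rangle$, with increasing enumerations $C_\delta=\{\alpha^\delta_\zeta:\zeta<\mu\}\subseteq\delta$ for $\delta\in S$, such that for every club $E\subseteq\lambda$ there is $\delta\in S$ for which $$\{\zeta<\mu:\alpha^\delta_{\zeta+1}\in E\}\ \text{ is stationary in } \mu.$$ Equivalently, $\underline{C}$ is such that for every club $E\subseteq\lambda$ the set of all $\delta\in S$ for which $\{\zeta<\mu:\alpha^\delta_{\zeta+1}\in E\}$ is stationary in $\mu$ is a stationary subset of $\lambda$.
   Context: Work in ZFC. For a cardinal $\lambda$ and a regular cardinal $\mu$, $S^\lambda_\mu$ denotes the set of ordinals $\delta<\lambda$ with cofinality $\mathrm{cf}(\delta)=\mu$. For $S\subseteq S^\lambda_\mu$, an $S$-club sequence is a sequence $\underline{C}=\langle C_\delta:\delta\in S\rangle$ such that for each $\delta\in S$, $C_\delta\subseteq\delta$ is a club (closed and unbounded subset) in $\delta$ of order type $\mu$. The enumeration $C_\delta=\{\alpha^\delta_\zeta:\zeta<\mu\}$ is the unique strictly increasing enumeration of $C_\delta$ (which is continuous, since $C_\delta$ is closed in $\delta$). *)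

theory Defs
  imports Main
begin

unbundle cardinal_syntax

text \<open>
  Ordinals are represented by well-orders (reflexive, as in the library's theory of cardinals):
  the ordinals below an ordinal \<open>r\<close> are the elements of \<^term>\<open>Field r\<close>, and such an element
  \<open>\<delta>\<close>, viewed as an ordinal in its own right, is the restriction of \<open>r\<close> to the strict
  predecessors of \<open>\<delta>\<close>. Equality of order types is \<open>=o\<close>.
\<close>

definition seg :: "'a rel \<Rightarrow> 'a \<Rightarrow> 'a rel" where
  "seg r \<delta> = Restr r (underS r \<delta>)"

text \<open>
  The cofinality is the least order type of an unbounded subset. Unboundedness is non-strict
  here, so that successors get cofinality 1; the library's \<^const>\<open>cofinal\<close> is strict,
  and no subset of a successor ordinal satisfies it.
\<close>

definition unbounded :: "'a rel \<Rightarrow> 'a set \<Rightarrow> bool" where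
  "unbounded r K \<longleftrightarrow> K \<subseteq> Field r \<and> (\<forall>a\<in>Field r. \<exists>b\<in>K. (a, b) \<in> r)"

definition has_cofinality :: "'a rel \<Rightarrow> 'm rel \<Rightarrow> bool" where
  "has_cofinality r \<mu> \<longleftrightarrow>
     (\<exists>K. unbounded r K \<and> Restr r K =o \<mu>) \<and>
     (\<forall>K. unbounded r K \<longrightarrow> \<mu> \<le>o Restr r K)"

definition cof_set :: "'a rel \<Rightarrow> 'm rel \<Rightarrow> 'a set" where
  "cof_set r \<mu> = {\<delta> \<in> Field r. has_cofinality (seg r \<delta>) \<mu>}"

text \<open>
  For \<open>\<beta> \<noteq> 0\<close>, strict cofinality of \<open>C \<inter> \<beta>\<close> in \<open>\<beta>\<close> says that \<open>\<beta>\<close> is a limit and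
  \<open>\<beta> = sup (C \<inter> \<beta>)\<close>. With \<^const>\<open>unbounded\<close> instead, a closed set would have to
  contain the successor of each of its elements.
\<close>

definition closed_in :: "'a rel \<Rightarrow> 'a set \<Rightarrow> bool" where
  "closed_in r C \<longleftrightarrow>
     (\<forall>\<beta>\<in>Field r. underS r \<beta> \<noteq> {} \<and> cofinal (C \<inter> underS r \<beta>) (seg r \<beta>) \<longrightarrow> \<beta> \<in> C)"

definition club :: "'a rel \<Rightarrow> 'a set \<Rightarrow> bool" where
  "club r C \<longleftrightarrow> unbounded r C \<and> closed_in r C"

definition stationary :: "'a rel \<Rightarrow> 'a set \<Rightarrow> bool" where
  "stationary r A \<longleftrightarrow> A \<subseteq> Field r \<and> (\<forall>E. club r E \<longrightarrow> A \<inter> E \<noteq> {})"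

text \<open>
  \<open>C\<close> is an \<open>S\<close>-club sequence, and \<open>\<alpha> \<delta> \<zeta>\<close> is the \<open>\<zeta>\<close>-th element of \<open>C \<delta>\<close>: an isomorphism of
  well-orders from \<open>\<mu>\<close> onto \<open>C \<delta>\<close> is determined on \<^term>\<open>Field \<mu>\<close>. Values of \<open>C\<close> and \<open>\<alpha>\<close>
  outside the intended domains are irrelevant.
\<close>

definition club_sequence :: "'a rel \<Rightarrow> 'm rel \<Rightarrow> 'a set \<Rightarrow> ('a \<Rightarrow> 'a set) \<Rightarrow> bool" where
  "club_sequence r \<mu> S C \<longleftrightarrow>
     (\<forall>\<delta>\<in>S. club (seg r \<delta>) (C \<delta>) \<and> Restr r (C \<delta>) =o \<mu>)"

definition enumerations ::
    "'a rel \<Rightarrow> 'm rel \<Rightarrow> 'a set \<Rightarrow> ('a \<Rightarrow> 'a set) \<Rightarrow> ('a \<Rightarrow> 'm \<Rightarrow> 'a) \<Rightarrow> bool" where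
  "enumerations r \<mu> S C \<alpha> \<longleftrightarrow> (\<forall>\<delta>\<in>S. iso \<mu> (Restr r (C \<delta>)) (\<alpha> \<delta>))"

abbreviation next_ord :: "'m rel \<Rightarrow> 'm \<Rightarrow> 'm" where
  "next_ord \<mu> \<zeta> \<equiv> wo_rel.suc \<mu> {\<zeta>}"

end

theory Submission
  imports Defs "HOL-Library.Nat_Bijection"
begin

text \<open>
  Write \<open>next\<^bsub>C\<^esub>(x)\<close> for the least element of \<open>C\<close> above \<open>x\<close>. The proof has two steps. Each assumes that
  no club sequence works and iterates the failure \<open>\<omega>\<close> times; each contradiction comes from a
  decreasing \<open>\<omega>\<close>-sequence of ordinals, which has to stabilise. Since \<open>\<mu>\<close> and \<open>\<lambda>\<close> have uncountable
  cofinality, all the clubs that occur along the way, in \<open>\<lambda>\<close> and in the points of \<open>S\<close>, may be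
  intersected at the end.

  \<^emph>\<open>Guessing gaps\<close> (\<open>gap_guessing\<close>). There is a \<open>C\<close> such that for every club \<open>E\<close> some \<open>\<delta> \<in> S\<close> has
  stationarily many \<open>x \<in> C\<^sub>\<delta>\<close> for which \<open>E\<close> meets \<open>(x, next\<^bsub>C\<^sub>\<delta>\<^esub>(x)]\<close>. Otherwise there are club
  sequences \<open>C\<^sub>n\<close> and clubs \<open>E\<^sub>n\<close>, with \<open>C\<^bsub>n+1,\<delta>\<^esub> \<subseteq> C\<^bsub>n,\<delta>\<^esub>\<close>, such that no \<open>x\<close> in \<open>C\<^bsub>n+1,\<delta>\<^esub>\<close> has a point of \<open>E\<^sub>n\<close>
  in its half-open gap in \<open>C\<^bsub>n,\<delta>\<^esub>\<close>. Let \<open>E\<close> be the intersection of the \<open>E\<^sub>n\<close> and \<open>a\<close> a common point of the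
  \<open>C\<^bsub>n,\<delta>\<^esub>\<close>. For \<open>e \<in> E\<close> above \<open>a\<close>, the last point of \<open>C\<^bsub>n,\<delta>\<^esub>\<close> up to \<open>e\<close> decreases with \<open>n\<close>, so it
  stabilises, and the stable value can only be \<open>e\<close> itself. Thus \<open>C\<^bsub>0,\<delta>\<^esub>\<close> contains an end segment of
  \<open>E \<inter> \<delta>\<close>, for every \<open>\<delta> \<in> S\<close>: all these sets are traces of the one set
  \<open>E\<close>. If \<open>\<delta>\<close> is a limit of points \<open>\<delta>\<^sub>1 \<in> S\<close> that are limits of \<open>E\<close>, then a proper initial segment of \<open>C\<^bsub>0,\<delta>\<^esub>\<close>, of order type less than \<open>\<mu>\<close>, is
  unbounded in some such \<open>\<delta>\<^sub>1\<close>, which has cofinality \<open>\<mu>\<close>.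

  \<^emph>\<open>Guessing next points\<close> (\<open>next_guessing\<close>). Take \<open>C\<close> from the first step and correct it to a club
  \<open>E\<close>: replace \<open>c \<in> C\<^sub>\<delta>\<close> by the last point of \<open>E\<close> up to \<open>c\<close>. This is a club of type \<open>\<mu>\<close> again if \<open>\<delta>\<close> is a
  limit of \<open>E\<close> (\<open>last_points_club\<close>). If no correction works, let \<open>E\<^bsub>n+1\<^esub> \<subseteq> E\<^sub>n\<close> be a
  club on which the correction to \<open>E\<^sub>n\<close> fails. Apply the first step to the intersection \<open>E\<close> of
  the \<open>E\<^sub>n\<close>, and let \<open>x \<in> C\<^sub>\<delta> \<inter> E\<close> have \<open>E\<close> meeting its gap. Its next point in the correction to \<open>E\<^sub>n\<close> is the
  last point of \<open>E\<^sub>n\<close> up to \<open>next\<^bsub>C\<^sub>\<delta>\<^esub>(x)\<close>. It decreases with \<open>n\<close>, so for some \<open>n\<close> it is the same for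
  \<open>n\<close> and \<open>n + 1\<close>, hence lies in \<open>E\<^bsub>n+1\<^esub>\<close>. As \<open>x\<close> may be chosen in any prescribed club of \<open>\<delta>\<close>,
  the correction to \<open>E\<^sub>n\<close> does not fail on \<open>E\<^bsub>n+1\<^esub>\<close> after all.

  For the equivalence, apply the guessing property to \<open>E \<inter> E'\<close>: the resulting \<open>\<delta>\<close> is a limit of
  \<open>E'\<close>, so it belongs to the given club \<open>E'\<close>.
\<close>

section \<open>Limit points and bounded sequences\<close>

definition limits :: "'a rel \<Rightarrow> 'a set \<Rightarrow> 'a set" where
  "limits r C = {\<beta> \<in> Field r. underS r \<beta> \<noteq> {} \<and>
     (\<forall>a\<in>underS r \<beta>. \<exists>b\<in>C. a \<in> underS r b \<and> b \<in> underS r \<beta>)}"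

definition next_in :: "'a rel \<Rightarrow> 'a set \<Rightarrow> 'a \<Rightarrow> 'a \<Rightarrow> bool" where
  "next_in r C x y \<longleftrightarrow> y \<in> C \<and> x \<in> underS r y \<and> (\<forall>z\<in>C. x \<in> underS r z \<longrightarrow> (y, z) \<in> r)"

definition last_upto :: "'a rel \<Rightarrow> 'a set \<Rightarrow> 'a \<Rightarrow> 'a \<Rightarrow> bool" where
  "last_upto r E c y \<longleftrightarrow> y \<in> E \<and> (y, c) \<in> r \<and> (\<forall>e\<in>E. (e, c) \<in> r \<longrightarrow> (e, y) \<in> r)"

text \<open>
  The set \<open>C\<close> corrected to \<open>E\<close>: every \<open>c \<in> C\<close> is moved down to the last element of \<open>E\<close> that does
  not exceed it. Elements of \<open>C\<close> below all of \<open>E\<close> disappear.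
\<close>

definition last_points :: "'a rel \<Rightarrow> 'a set \<Rightarrow> 'a set \<Rightarrow> 'a set" where
  "last_points r E C = {y. \<exists>c\<in>C. last_upto r E c y}"

text \<open>
  For a nonempty order this is uncountable cofinality together with the absence of a maximum.
\<close>

definition omega_bounded :: "'a rel \<Rightarrow> bool" where
  "omega_bounded r \<longleftrightarrow>
     (\<forall>x :: nat \<Rightarrow> 'a. (\<forall>n. x n \<in> Field r) \<longrightarrow> (\<exists>b\<in>Field r. \<forall>n. x n \<in> underS r b))"

section \<open>Well-orders and their strict part\<close>

context wo_rel
begin

abbreviation less_eq_ord (infix "\<preceq>" 50) where "x \<preceq> y \<equiv> (x, y) \<in> r"
abbreviation less_ord (infix "\<prec>" 50) where "x \<prec> y \<equiv> x \<in> underS y"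

lemma less_iff: "x \<prec> y \<longleftrightarrow> x \<preceq> y \<and> x \<noteq> y"
  by (auto simp: underS_def)

lemma le_refl: "x \<in> Field r \<Longrightarrow> x \<preceq> x"
  using REFL by (auto simp: refl_on_def)

lemma le_trans: "x \<preceq> y \<Longrightarrow> y \<preceq> z \<Longrightarrow> x \<preceq> z"
  using TRANS by (auto dest: transD)

lemma le_antisym: "x \<preceq> y \<Longrightarrow> y \<preceq> x \<Longrightarrow> x = y"
  using ANTISYM by (auto dest: antisymD)

lemma le_Field: "x \<preceq> y \<Longrightarrow> x \<in> Field r" "x \<preceq> y \<Longrightarrow> y \<in> Field r"
  by (auto simp: Field_def)

lemma less_Field: "x \<prec> y \<Longrightarrow> x \<in> Field r" "x \<prec> y \<Longrightarrow> y \<in> Field r"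
  by (auto simp: less_iff dest: le_Field)

lemma less_imp_le: "x \<prec> y \<Longrightarrow> x \<preceq> y"
  by (simp add: less_iff)

lemma less_irrefl: "\<not> x \<prec> x"
  by (simp add: less_iff)

lemma le_less_trans: "x \<preceq> y \<Longrightarrow> y \<prec> z \<Longrightarrow> x \<prec> z"
  unfolding less_iff using le_trans le_antisym by blast

lemma less_le_trans: "x \<prec> y \<Longrightarrow> y \<preceq> z \<Longrightarrow> x \<prec> z"
  unfolding less_iff using le_trans le_antisym by blast

lemma less_trans: "x \<prec> y \<Longrightarrow> y \<prec> z \<Longrightarrow> x \<prec> z"
  using less_imp_le le_less_trans by blast

lemma not_less: "x \<in> Field r \<Longrightarrow> y \<in> Field r \<Longrightarrow> \<not> x \<prec> y \<longleftrightarrow> y \<preceq> x"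
  unfolding less_iff using TOTALS le_antisym le_refl by blast

lemma not_le: "x \<in> Field r \<Longrightarrow> y \<in> Field r \<Longrightarrow> \<not> x \<preceq> y \<longleftrightarrow> y \<prec> x"
  using not_less by blast

lemma least_exists:
  assumes "A \<subseteq> Field r" and "A \<noteq> {}"
  shows "\<exists>m\<in>A. \<forall>x\<in>A. m \<preceq> x"
  using minim_in[OF assms] minim_least[OF assms(1)] by blast

text \<open>
  Both guessing arguments end with this form of well-foundedness.
\<close>

lemma decreasing_stabilizes:
  assumes "\<And>n :: nat. y (Suc n) \<preceq> y n"
  shows "\<exists>n. \<forall>m\<ge>n. y m = y n"
proof -
  have "range y \<subseteq> Field r" using assms le_Field by blast
  then obtain n where n: "\<And>m. y n \<preceq> y m" using least_exists[of "range y"] by auto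
  have "y m \<preceq> y n" if "n \<le> m" for m
    using that
  proof (induction m rule: dec_induct)
    case base show ?case using n .
  next
    case (step m) then show ?case using assms le_trans by blast
  qed
  then show ?thesis using n le_antisym by blast
qed

section \<open>Limit points and clubs, also below a point\<close>

lemma limitsI:
  assumes "x \<prec> \<beta>" and "\<And>a. a \<prec> \<beta> \<Longrightarrow> \<exists>b\<in>C. a \<prec> b \<and> b \<prec> \<beta>"
  shows "\<beta> \<in> limits r C"
  using assms less_Field unfolding limits_def by blast

lemma limitsD: "\<beta> \<in> limits r C \<Longrightarrow> a \<prec> \<beta> \<Longrightarrow> \<exists>b\<in>C. a \<prec> b \<and> b \<prec> \<beta>"
  unfolding limits_def by blast

lemma limits_mono: "C \<subseteq> D \<Longrightarrow> limits r C \<subseteq> limits r D"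
  unfolding limits_def by blast

lemma limits_Un_limits: "limits r (C \<union> limits r C) \<subseteq> limits r C"
proof
  fix \<beta> assume \<beta>: "\<beta> \<in> limits r (C \<union> limits r C)"
  then obtain x where "x \<prec> \<beta>" unfolding limits_def by blast
  then show "\<beta> \<in> limits r C"
  proof (rule limitsI)
    fix a assume "a \<prec> \<beta>"
    then obtain b where b: "b \<in> C \<union> limits r C" "a \<prec> b" "b \<prec> \<beta>" using limitsD[OF \<beta>] by blast
    then show "\<exists>b\<in>C. a \<prec> b \<and> b \<prec> \<beta>"
      by (metis UnE limitsD less_trans)
  qed
qed

lemma Field_seg: "Field (seg r \<delta>) = underS \<delta>"
  unfolding seg_def using Refl_Field_Restr2[OF REFL, of "underS \<delta>"] less_Field(1) by blast

lemma Well_order_seg: "Well_order (seg r \<delta>)"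
  unfolding seg_def by (rule Well_order_Restr[OF WELL])

lemma Restr_seg: "A \<subseteq> underS \<delta> \<Longrightarrow> Restr (seg r \<delta>) A = Restr r A"
  unfolding seg_def by blast

lemma underS_seg: "\<beta> \<prec> \<delta> \<Longrightarrow> Order_Relation.underS (seg r \<delta>) \<beta> = underS \<beta>"
  using less_trans[of _ \<beta> \<delta>] unfolding seg_def underS_def by blast

lemma closed_in_iff: "closed_in r C \<longleftrightarrow> limits r C \<subseteq> C"
proof -
  have "cofinal (C \<inter> underS \<beta>) (seg r \<beta>) \<longleftrightarrow> (\<forall>a\<in>underS \<beta>. \<exists>b\<in>C. a \<prec> b \<and> b \<prec> \<beta>)" for \<beta>
    unfolding cofinal_def Field_seg by (auto simp: seg_def underS_def)
  then show ?thesis unfolding closed_in_def limits_def by blast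
qed

text \<open>
  Being a limit of \<open>C\<close> only concerns what lies below a point, so clubs in \<open>\<delta>\<close> can be described by
  the limit points of the ambient order.
\<close>

lemma limits_seg: "limits (seg r \<delta>) C = limits r C \<inter> underS \<delta>"
proof -
  have "\<beta> \<in> limits (seg r \<delta>) C \<longleftrightarrow> \<beta> \<in> limits r C" if \<beta>: "\<beta> \<prec> \<delta>" for \<beta>
  proof -
    have "a \<in> Order_Relation.underS (seg r \<delta>) b \<longleftrightarrow> a \<prec> b" if "b \<prec> \<beta>" for a b
      using underS_seg less_trans[OF that \<beta>] by blast
    then show ?thesis
      unfolding limits_def mem_Collect_eq Field_seg underS_seg[OF \<beta>]
      using \<beta> less_Field by blast
  qed
  moreover have "limits (seg r \<delta>) C \<subseteq> underS \<delta>"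
    unfolding limits_def Field_seg by blast
  ultimately show ?thesis by blast
qed

lemma unbounded_seg_iff:
  "unbounded (seg r \<delta>) C \<longleftrightarrow> C \<subseteq> underS \<delta> \<and> (\<forall>a. a \<prec> \<delta> \<longrightarrow> (\<exists>b\<in>C. a \<preceq> b))"
  unfolding unbounded_def Field_seg unfolding seg_def by blast

lemma club_seg_iff:
  "club (seg r \<delta>) C \<longleftrightarrow> unbounded (seg r \<delta>) C \<and> (\<forall>\<beta>\<in>limits r C. \<beta> \<prec> \<delta> \<longrightarrow> \<beta> \<in> C)"
proof -
  interpret s: wo_rel "seg r \<delta>" using Well_order_seg by (simp add: wo_rel_def)
  show ?thesis unfolding club_def s.closed_in_iff limits_seg by blast
qed

lemma club_iff: "club r C \<longleftrightarrow> unbounded r C \<and> limits r C \<subseteq> C"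
  unfolding club_def closed_in_iff ..

lemma club_Field: "club r (Field r)"
  unfolding club_iff unbounded_def limits_def using le_refl by blast

text \<open>
  The least upper bound of the elements of \<open>E\<close> up to \<open>c\<close> lies in \<open>E\<close>: otherwise it would be
  a limit of \<open>E\<close> outside \<open>E\<close>. Closure is required only up to \<open>c\<close>, so that clubs in a point
  \<open>\<delta>\<close> above \<open>c\<close> qualify too.
\<close>

lemma last_upto_exists:
  assumes "E \<subseteq> Field r" and "e\<^sub>0 \<in> E" and "e\<^sub>0 \<preceq> c"
    and closed: "\<And>\<beta>. \<beta> \<in> limits r E \<Longrightarrow> \<beta> \<preceq> c \<Longrightarrow> \<beta> \<in> E"
  shows "\<exists>y. last_upto r E c y"
proof -
  let ?U = "{u \<in> Field r. \<forall>e\<in>E. e \<preceq> c \<longrightarrow> e \<preceq> u}"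
  have c: "c \<in> ?U" using assms(3) le_Field by blast
  then obtain s where s: "s \<in> ?U" and least: "\<And>u. u \<in> ?U \<Longrightarrow> s \<preceq> u"
    using least_exists[of ?U] by blast
  have "s \<in> E"
  proof (rule ccontr)
    assume "s \<notin> E"
    then have "e\<^sub>0 \<prec> s" using s assms(2,3) less_iff by blast
    then have "s \<in> limits r E"
    proof (rule limitsI)
      fix a assume a: "a \<prec> s"
      then have "a \<notin> ?U" using least le_less_trans less_irrefl by blast
      then obtain e where "e \<in> E" "e \<preceq> c" "a \<prec> e"
        using a less_Field not_le le_Field by blast
      then show "\<exists>b\<in>E. a \<prec> b \<and> b \<prec> s" using s \<open>s \<notin> E\<close> less_iff[of e s] by blast
    qed
    then show False using closed least[OF c] \<open>s \<notin> E\<close> by blast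
  qed
  then show ?thesis unfolding last_upto_def using s least[OF c] by blast
qed

section \<open>Clubs in orders of uncountable cofinality\<close>

text \<open>
  Climb through the sets \<open>U n\<close> in \<open>\<omega>\<close> steps, visiting each of them infinitely often; the supremum
  of the climb is a limit of them all.
\<close>

lemma common_limit:
  fixes U :: "nat \<Rightarrow> 'a set"
  assumes ob: "omega_bounded r" and U: "\<And>n. unbounded r (U n)" and a: "a \<in> Field r"
  shows "\<exists>\<beta>. a \<prec> \<beta> \<and> (\<forall>n. \<beta> \<in> limits r (U n))"
proof -
  have ex: "\<exists>y. x \<in> Field r \<longrightarrow> y \<in> U n \<and> x \<prec> y" for n x
  proof (cases "x \<in> Field r")
    case True
    then obtain b where "b \<in> Field r" "x \<prec> b"
      using ob[unfolded omega_bounded_def, rule_format, of "\<lambda>_. x"] by blast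
    then show ?thesis using U[of n] less_le_trans unfolding unbounded_def by blast
  qed blast
  define g where "g n x = (SOME y. x \<in> Field r \<longrightarrow> y \<in> U n \<and> x \<prec> y)" for n x
  have g: "g n x \<in> U n \<and> x \<prec> g n x" if "x \<in> Field r" for n x
    using someI_ex[OF ex[of x n]] that unfolding g_def by blast
  \<comment> \<open>Every \<open>U n\<close> is visited at arbitrarily late stages.\<close>
  define x where "x = rec_nat a (\<lambda>k. g (fst (prod_decode k)))"
  have x0: "x 0 = a" and xSuc: "x (Suc k) = g (fst (prod_decode k)) (x k)" for k
    by (simp_all add: x_def)
  have xF: "x k \<in> Field r" for k
  proof (induction k)
    case 0 show ?case using a x0 by simp
  next
    case (Suc k) then show ?case using g[OF Suc.IH] less_Field(2) xSuc[of k] by metis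
  qed
  have step: "x k \<prec> x (Suc k)" for k using g[OF xF] xSuc by simp
  have mono: "x k \<preceq> x l" if "k \<le> l" for k l
    using that
  proof (induction l rule: dec_induct)
    case base show ?case using le_refl[OF xF] .
  next
    case (step l) then show ?case using \<open>x l \<prec> x (Suc l)\<close> le_trans less_imp_le by blast
  qed
  let ?B = "{b \<in> Field r. \<forall>n. x n \<prec> b}"
  have "?B \<noteq> {}" using ob xF unfolding omega_bounded_def by blast
  then obtain \<beta> where \<beta>: "\<beta> \<in> ?B" and least: "\<And>b. b \<in> ?B \<Longrightarrow> \<beta> \<preceq> b"
    using least_exists[of ?B] by blast
  have "\<beta> \<in> limits r (U n)" for n
  proof (rule limitsI[of a])
    show "a \<prec> \<beta>" using \<beta> x0 by (metis (mono_tags, lifting) mem_Collect_eq)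
    fix c assume c: "c \<prec> \<beta>"
    then have "c \<notin> ?B" using least le_less_trans less_irrefl by blast
    then obtain k where k: "c \<preceq> x k" using c less_Field not_less xF by blast
    define l where "l = prod_encode (n, k)"
    have "c \<preceq> x l" using k mono[of k l] le_trans le_prod_encode_2 unfolding l_def by blast
    then have "c \<prec> x (Suc l)" using step le_less_trans by blast
    moreover have "x (Suc l) \<in> U n" using g[OF xF] xSuc[of l] by (simp add: l_def)
    ultimately show "\<exists>b\<in>U n. c \<prec> b \<and> b \<prec> \<beta>" using \<beta> by blast
  qed
  moreover have "a \<prec> \<beta>" using \<beta> x0 by (metis (mono_tags, lifting) mem_Collect_eq)
  ultimately show ?thesis by blast
qed

lemma club_INT:
  fixes C :: "nat \<Rightarrow> 'a set"
  assumes "omega_bounded r" and "\<And>n. club r (C n)"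
  shows "club r (\<Inter>n. C n)"
proof -
  have C: "unbounded r (C n)" "limits r (C n) \<subseteq> C n" for n
    using assms(2) unfolding club_iff by blast+
  have "\<exists>b\<in>\<Inter>n. C n. a \<preceq> b" if a: "a \<in> Field r" for a
  proof -
    obtain \<beta> where "a \<prec> \<beta>" "\<forall>n. \<beta> \<in> limits r (C n)"
      using common_limit[of C, OF assms(1) C(1) a] by auto
    then have "a \<preceq> \<beta>" "\<beta> \<in> (\<Inter>n. C n)" using C(2) less_imp_le by auto
    then show ?thesis by blast
  qed
  moreover have "limits r (\<Inter>n. C n) \<subseteq> (\<Inter>n. C n)"
  proof (rule INT_greatest)
    show "limits r (\<Inter>n. C n) \<subseteq> C n" for n
      using C(2)[of n] limits_mono[of "\<Inter>n. C n" "C n"] by blast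
  qed
  moreover have "(\<Inter>n. C n) \<subseteq> Field r" using C(1)[of 0] unfolding unbounded_def by blast
  ultimately show ?thesis unfolding club_iff unbounded_def by blast
qed

lemma club_Int:
  assumes "omega_bounded r" and "club r C" and "club r D"
  shows "club r (C \<inter> D)"
proof -
  have "club r (\<Inter>n::nat. if n = 0 then C else D)"
    by (rule club_INT) (use assms in auto)
  moreover have "(\<Inter>n::nat. if n = 0 then C else D) = C \<inter> D"
    by (auto split: if_splits)
  ultimately show ?thesis by simp
qed

lemma club_limits:
  assumes "omega_bounded r" and "unbounded r U"
  shows "club r (limits r U)"
proof -
  have "\<exists>b\<in>limits r U. a \<preceq> b" if "a \<in> Field r" for a
    using common_limit[OF assms(1), of "\<lambda>_. U", OF assms(2) that] less_imp_le by auto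
  moreover have "limits r (limits r U) \<subseteq> limits r U"
    using limits_mono[of "limits r U" "U \<union> limits r U"] limits_Un_limits by blast
  moreover have "limits r U \<subseteq> Field r" unfolding limits_def by blast
  ultimately show ?thesis unfolding club_iff unbounded_def by blast
qed

lemma tail_club:
  assumes nomax: "\<And>a. a \<in> Field r \<Longrightarrow> \<exists>b. a \<prec> b" and a: "a \<in> Field r"
  shows "club r {x. a \<prec> x}"
proof -
  have "\<exists>b\<in>{x. a \<prec> x}. c \<preceq> b" if c: "c \<in> Field r" for c
  proof (cases "a \<prec> c")
    case True then show ?thesis using le_refl c by blast
  next
    case False
    then have "c \<preceq> a" using a c not_less by blast
    then show ?thesis using nomax[OF a] le_trans less_imp_le by blast
  qed
  moreover have "limits r {x. a \<prec> x} \<subseteq> {x. a \<prec> x}"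
    unfolding limits_def using less_trans by blast
  ultimately show ?thesis unfolding club_iff unbounded_def using less_Field by blast
qed

lemma stationary_unbounded:
  assumes nomax: "\<And>a. a \<in> Field r \<Longrightarrow> \<exists>b. a \<prec> b" and "stationary r A"
  shows "unbounded r A"
  using assms(2) tail_club[OF nomax] less_imp_le unfolding stationary_def unbounded_def by blast

lemma stationary_Int_club:
  assumes "omega_bounded r" and "stationary r A" and "club r C"
  shows "stationary r (A \<inter> C)"
  using assms club_Int[OF assms(1,3)] unfolding stationary_def by blast

section \<open>Order types of unbounded sets\<close>

text \<open>
  If \<open>B\<close> were shorter than \<open>A\<close>, then \<open>f\<close> followed by an isomorphism of \<open>B\<close> with a proper initial
  segment of \<open>A\<close> would be a strictly increasing map of \<open>A\<close> into that segment. It would move some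
  points downwards, which is impossible in a well-order.
\<close>

lemma Restr_ordLeq_strict_mono:
  assumes A: "A \<subseteq> Field r" and B: "B \<subseteq> Field r" and f: "f ` A \<subseteq> B"
    and mono: "\<And>x y. x \<in> A \<Longrightarrow> y \<in> A \<Longrightarrow> x \<prec> y \<Longrightarrow> f x \<prec> f y"
  shows "Restr r A \<le>o Restr r B"
proof (rule ccontr)
  have wo: "Well_order (Restr r X)" for X by (rule Well_order_Restr[OF WELL])
  have FA: "Field (Restr r A) = A" and FB: "Field (Restr r B) = B"
    using Refl_Field_Restr2[OF REFL] A B by blast+
  assume "\<not> Restr r A \<le>o Restr r B"
  then have "Restr r B <o Restr r A" using not_ordLeq_iff_ordLess wo by blast
  then obtain a where a: "a \<in> A"
    and "Restr r B =o Restr (Restr r A) (Order_Relation.underS (Restr r A) a)"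
    using ordLess_iff_ordIso_Restr[OF wo wo] FA by metis
  then obtain g where g: "iso (Restr r B) (Restr (Restr r A) (Order_Relation.underS (Restr r A) a)) g"
    unfolding ordIso_def by blast
  define h where "h = g \<circ> f"
  have h: "h x \<in> A \<and> h x \<prec> a" if "x \<in> A" for x
  proof -
    have "(f x, f x) \<in> Restr r B" using that f B le_refl by blast
    then have "(h x, h x) \<in> Restr (Restr r A) (Order_Relation.underS (Restr r A) a)"
      using iso_forward[OF _ g] by (simp add: h_def)
    then show ?thesis by (auto simp: underS_def)
  qed
  have hmono: "h x \<prec> h y" if "x \<in> A" "y \<in> A" "x \<prec> y" for x y
  proof -
    have fxy: "f x \<prec> f y" "f x \<in> B" "f y \<in> B" using mono that f by blast+
    then have "(f x, f y) \<in> Restr r B" using less_imp_le by blast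
    then have "(h x, h y) \<in> r" using iso_forward[OF _ g] by (fastforce simp: h_def)
    moreover have "h x \<noteq> h y"
    proof
      assume "h x = h y"
      then have "f x = f y" using g fxy unfolding iso_iff2 FB bij_betw_def h_def
        by (auto dest: inj_onD)
      then show False using fxy less_irrefl by simp
    qed
    ultimately show ?thesis by (simp add: less_iff)
  qed
  \<comment> \<open>The least point moved downwards would be moved to a smaller such point.\<close>
  let ?M = "{x \<in> A. h x \<prec> x}"
  have "a \<in> ?M" using a h by blast
  then obtain m where m: "m \<in> ?M" "\<And>x. x \<in> ?M \<Longrightarrow> m \<preceq> x"
    using least_exists[of ?M] A by blast
  have "h m \<in> ?M" using m(1) h hmono by blast
  then show False using m le_less_trans less_irrefl by blast
qed

text \<open>
  An unbounded set in a point of cofinality \<open>\<mu>\<close> has type at least \<open>\<mu>\<close>, so a strictly increasing map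
  into a set of type at most \<open>\<mu>\<close> determines its type. All club sequences below get their order types
  in this way.
\<close>

lemma Restr_ordIso_cofinality:
  assumes cof: "has_cofinality (seg r \<delta>) \<mu>"
    and G: "unbounded (seg r \<delta>) G" and C: "C \<subseteq> Field r" "Restr r C \<le>o \<mu>"
    and f: "f ` G \<subseteq> C" "\<And>x y. x \<in> G \<Longrightarrow> y \<in> G \<Longrightarrow> x \<prec> y \<Longrightarrow> f x \<prec> f y"
  shows "Restr r G =o \<mu>"
proof -
  have G': "G \<subseteq> underS \<delta>" using G unfolding unbounded_seg_iff by blast
  then have "G \<subseteq> Field r" using less_Field by blast
  then have "Restr r G \<le>o Restr r C" using Restr_ordLeq_strict_mono C(1) f by blast
  then have "Restr r G \<le>o \<mu>" using C(2) ordLeq_transitive by blast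
  moreover have "\<mu> \<le>o Restr r G"
    using cof G Restr_seg[OF G'] unfolding has_cofinality_def by metis
  ultimately show ?thesis using ordIso_iff_ordLeq by blast
qed

lemma omega_bounded_seg:
  assumes "Card_order \<mu>" and "natLeq <o \<mu>" and cof: "has_cofinality (seg r \<delta>) \<mu>"
  shows "omega_bounded (seg r \<delta>)"
  unfolding omega_bounded_def
proof (intro allI impI)
  fix x :: "nat \<Rightarrow> 'a" assume x: "\<forall>n. x n \<in> Field (seg r \<delta>)"
  have xd: "x n \<prec> \<delta>" for n using x Field_seg by blast
  show "\<exists>b\<in>Field (seg r \<delta>). \<forall>n. x n \<in> Order_Relation.underS (seg r \<delta>) b"
  proof (rule ccontr)
    assume *: "\<not> ?thesis"
    have "\<exists>n. a \<preceq> x n" if a: "a \<prec> \<delta>" for a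
    proof -
      obtain n where "\<not> x n \<prec> a" using * a underS_seg[OF a] Field_seg by blast
      then show ?thesis using not_less less_Field a xd by blast
    qed
    then have "unbounded (seg r \<delta>) (range x)" unfolding unbounded_seg_iff using xd by blast
    then have "\<mu> \<le>o Restr (seg r \<delta>) (range x)" using cof unfolding has_cofinality_def by blast
    then have "|Field \<mu>| \<le>o |Field (Restr (seg r \<delta>) (range x))|" by (rule card_of_mono2)
    also have "|Field (Restr (seg r \<delta>) (range x))| \<le>o |range x|"
      by (rule card_of_mono1[OF Field_Restr_subset])
    also have "|range x| \<le>o |UNIV :: nat set|" by (rule card_of_image)
    also have "|UNIV :: nat set| =o natLeq" by (rule card_of_nat)
    finally have "|Field \<mu>| \<le>o natLeq" .
    then have "\<mu> \<le>o natLeq"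
      using card_of_Field_ordIso[OF assms(1)] ordIso_symmetric ordIso_ordLeq_trans by blast
    then show False using assms(2) not_ordLess_ordLeq by blast
  qed
qed

text \<open>
  The closure of an unbounded \<open>K\<close> of type \<open>\<mu>\<close> still has type \<open>\<mu>\<close>: sending a point to the next element of \<open>K\<close>
  strictly above it is strictly increasing on the closure, because there is an element of \<open>K\<close>
  in \<open>(x, y]\<close> whenever \<open>x < y\<close> are in the closure.
\<close>

lemma club_seg_exists:
  assumes ob: "omega_bounded (seg r \<delta>)" and cof: "has_cofinality (seg r \<delta>) \<mu>"
  shows "\<exists>C. club (seg r \<delta>) C \<and> Restr r C =o \<mu>"
proof -
  obtain K where K: "unbounded (seg r \<delta>) K" and type: "Restr (seg r \<delta>) K =o \<mu>"
    using cof unfolding has_cofinality_def by blast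
  have Kd: "K \<subseteq> underS \<delta>" and KF: "K \<subseteq> Field r"
    using K less_Field unfolding unbounded_seg_iff by blast+
  define C where "C = (K \<union> limits r K) \<inter> underS \<delta>"
  have unb: "unbounded (seg r \<delta>) C"
    using K unfolding C_def unbounded_seg_iff by blast
  have "limits r C \<subseteq> limits r K"
    using limits_mono[of C "K \<union> limits r K"] limits_Un_limits unfolding C_def by blast
  then have club: "club (seg r \<delta>) C"
    using unb unfolding club_seg_iff C_def by blast
  let ?P = "\<lambda>x k. k \<in> K \<and> x \<prec> k \<and> (\<forall>k'\<in>K. x \<prec> k' \<longrightarrow> k \<preceq> k')"
  have ex: "\<exists>k. ?P x k" if x: "x \<prec> \<delta>" for x
  proof -
    obtain b where b: "b \<prec> \<delta>" "x \<in> Order_Relation.underS (seg r \<delta>) b"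
      using ob[unfolded omega_bounded_def Field_seg, rule_format, of "\<lambda>_. x"] x by blast
    then have "x \<prec> b" using underS_seg by blast
    then obtain k where "k \<in> K" "x \<prec> k"
      using K b(1) less_le_trans unfolding unbounded_seg_iff by blast
    then show ?thesis using least_exists[of "{k \<in> K. x \<prec> k}"] KF by blast
  qed
  define f where "f x = (SOME k. ?P x k)" for x
  have f: "?P x (f x)" if "x \<prec> \<delta>" for x using someI_ex[OF ex[OF that]] unfolding f_def .
  have "Restr r C =o \<mu>"
  proof (rule Restr_ordIso_cofinality[OF cof unb KF])
    show "Restr r K \<le>o \<mu>" using type Restr_seg[OF Kd] ordIso_imp_ordLeq by metis
    show "f ` C \<subseteq> K" using f unfolding C_def by blast
    fix x y assume xy: "x \<in> C" "y \<in> C" "x \<prec> y"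
    then have d: "x \<prec> \<delta>" "y \<prec> \<delta>" unfolding C_def by blast+
    have "\<exists>k\<in>K. x \<prec> k \<and> k \<preceq> y"
      using xy limitsD[of y K x] less_imp_le le_refl less_Field unfolding C_def by blast
    then have "f x \<preceq> y" using f[OF d(1)] le_trans by blast
    then show "f x \<prec> f y" using f[OF d(2)] le_less_trans by blast
  qed
  then show ?thesis using club by blast
qed

lemma club_seg_subset_type:
  assumes "has_cofinality (seg r \<delta>) \<mu>" and "club (seg r \<delta>) C" and "Restr r C =o \<mu>"
    and "club (seg r \<delta>) D" and "D \<subseteq> C"
  shows "Restr r D =o \<mu>"
proof (rule Restr_ordIso_cofinality[OF assms(1), where f = id and C = C])
  show "unbounded (seg r \<delta>) D" using assms(4) by (simp add: club_seg_iff)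
  show "C \<subseteq> Field r" using assms(2) less_Field unfolding club_seg_iff unbounded_seg_iff by blast
qed (use assms ordIso_imp_ordLeq in auto)

lemma club_seg_Int:
  assumes "omega_bounded (seg r \<delta>)" and "club (seg r \<delta>) C" and "club (seg r \<delta>) D"
  shows "club (seg r \<delta>) (C \<inter> D)"
proof -
  interpret s: wo_rel "seg r \<delta>" using Well_order_seg by (simp add: wo_rel_def)
  show ?thesis using s.club_Int assms .
qed

lemma club_seg_INT:
  fixes C :: "nat \<Rightarrow> 'a set"
  assumes "omega_bounded (seg r \<delta>)" and "\<And>n. club (seg r \<delta>) (C n)"
  shows "club (seg r \<delta>) (\<Inter>n. C n)"
proof -
  interpret s: wo_rel "seg r \<delta>" using Well_order_seg by (simp add: wo_rel_def)
  show ?thesis using s.club_INT assms .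
qed

lemma club_Int_seg:
  assumes "club r E" and "\<delta> \<in> limits r E"
  shows "club (seg r \<delta>) (E \<inter> underS \<delta>)"
proof -
  have "limits r (E \<inter> underS \<delta>) \<subseteq> E"
    using assms(1) limits_mono[of "E \<inter> underS \<delta>" E] unfolding club_iff by blast
  moreover have "\<exists>b\<in>E \<inter> underS \<delta>. a \<preceq> b" if "a \<prec> \<delta>" for a
    using limitsD[OF assms(2) that] less_imp_le by blast
  ultimately show ?thesis unfolding club_seg_iff unbounded_seg_iff by blast
qed

lemma initial_part_ordLess:
  assumes "C \<subseteq> Field r" and "\<delta> \<in> C"
  shows "Restr r (C \<inter> underS \<delta>) <o Restr r C"
proof -
  have F: "Field (Restr r C) = C" using Refl_Field_Restr2[OF REFL assms(1)] .
  have "Restr (Restr r C) (Order_Relation.underS (Restr r C) \<delta>) <o Restr r C"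
    by (rule underS_Restr_ordLess[OF Well_order_Restr[OF WELL]]) (use F assms(2) in blast)
  moreover have "Order_Relation.underS (Restr r C) \<delta> = C \<inter> underS \<delta>"
    using assms(2) by (auto simp: underS_def)
  moreover have "Restr (Restr r C) (C \<inter> underS \<delta>) = Restr r (C \<inter> underS \<delta>)" by blast
  ultimately show ?thesis by simp
qed

section \<open>Guessing gaps\<close>

lemma omega_bounded_no_max: "omega_bounded r \<Longrightarrow> a \<in> Field r \<Longrightarrow> \<exists>b. a \<prec> b"
  unfolding omega_bounded_def by (drule spec[of _ "\<lambda>_. a"]) blast

lemma cof_setD: "\<delta> \<in> cof_set r \<mu> \<Longrightarrow> \<delta> \<in> Field r \<and> has_cofinality (seg r \<delta>) \<mu>"
  unfolding cof_set_def by blast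

text \<open>
  In the set below, \<open>e\<close> lies in the half-open gap that follows \<open>x\<close> in \<open>C \<delta>\<close>. If this fails for every club
  sequence, then a sequence of successive thinnings of one club sequence forces a single club \<open>E\<close>
  to have order type at most \<open>\<mu>\<close> in an end segment of each \<open>\<delta> \<in> S\<close>. This is impossible if \<open>\<delta>\<close> is
  a limit of points of \<open>S\<close> that are themselves limits of \<open>E\<close>.
\<close>

lemma gap_guessing:
  fixes \<mu> :: "'m rel"
  assumes "Card_order \<mu>" and "natLeq <o \<mu>" and ob: "omega_bounded r"
    and S: "S \<subseteq> cof_set r \<mu>" and stat: "stationary r S"
  shows "\<exists>C. club_sequence r \<mu> S C \<and> (\<forall>E. club r E \<longrightarrow>
    (\<exists>\<delta>\<in>S. stationary (seg r \<delta>) {x \<in> C \<delta>. \<exists>e\<in>E. x \<prec> e \<and> (\<forall>z\<in>C \<delta>. x \<prec> z \<longrightarrow> e \<preceq> z)}))"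
proof (rule ccontr)
  assume no: "\<not> ?thesis"
  have cof: "has_cofinality (seg r \<delta>) \<mu>" if "\<delta> \<in> S" for \<delta>
    using that S cof_setD by blast
  have ob': "omega_bounded (seg r \<delta>)" if "\<delta> \<in> S" for \<delta>
    using omega_bounded_seg assms(1,2) cof[OF that] by blast
  let ?Q = "\<lambda>C E D. club r E \<and> (\<forall>\<delta>\<in>S. club (seg r \<delta>) (D \<delta>) \<and>
    (\<forall>x\<in>C \<delta> \<inter> D \<delta>. \<forall>e\<in>E. x \<prec> e \<longrightarrow> (\<exists>z\<in>C \<delta>. x \<prec> z \<and> z \<prec> e)))"
  have bad: "\<exists>p. ?Q C (fst p) (snd p)" if C: "club_sequence r \<mu> S C" for C
  proof -
    obtain E where E: "club r E" and ns: "\<And>\<delta>. \<delta> \<in> S \<Longrightarrow> \<not> stationary (seg r \<delta>)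
        {x \<in> C \<delta>. \<exists>e\<in>E. x \<prec> e \<and> (\<forall>z\<in>C \<delta>. x \<prec> z \<longrightarrow> e \<preceq> z)}"
      using no C by blast
    have "\<exists>D. club (seg r \<delta>) D \<and>
        (\<forall>x\<in>C \<delta> \<inter> D. \<forall>e\<in>E. x \<prec> e \<longrightarrow> (\<exists>z\<in>C \<delta>. x \<prec> z \<and> z \<prec> e))" if \<delta>: "\<delta> \<in> S" for \<delta>
    proof -
      have Cd: "C \<delta> \<subseteq> underS \<delta>"
        using C \<delta> unfolding club_sequence_def club_seg_iff unbounded_seg_iff by blast
      then obtain D where D: "club (seg r \<delta>) D"
        "D \<inter> {x \<in> C \<delta>. \<exists>e\<in>E. x \<prec> e \<and> (\<forall>z\<in>C \<delta>. x \<prec> z \<longrightarrow> e \<preceq> z)} = {}"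
        using ns[OF \<delta>] unfolding stationary_def Field_seg by blast
      have "\<exists>z\<in>C \<delta>. x \<prec> z \<and> z \<prec> e" if "x \<in> C \<delta> \<inter> D" "e \<in> E" "x \<prec> e" for x e
      proof -
        have "\<not> (\<forall>z\<in>C \<delta>. x \<prec> z \<longrightarrow> e \<preceq> z)"
          using D(2) that by fast
        then obtain z where "z \<in> C \<delta>" "x \<prec> z" "\<not> e \<preceq> z" by fast
        moreover from this have "z \<prec> e"
          using not_le[of e z] less_Field(2)[of x z] less_Field(2)[OF that(3)] by fast
        ultimately show ?thesis by fast
      qed
      then show ?thesis using D(1) by blast
    qed
    then obtain D where "\<forall>\<delta>\<in>S. club (seg r \<delta>) (D \<delta>) \<and>
        (\<forall>x\<in>C \<delta> \<inter> D \<delta>. \<forall>e\<in>E. x \<prec> e \<longrightarrow> (\<exists>z\<in>C \<delta>. x \<prec> z \<and> z \<prec> e))"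
      using bchoice[of S "\<lambda>\<delta> D. club (seg r \<delta>) D \<and>
        (\<forall>x\<in>C \<delta> \<inter> D. \<forall>e\<in>E. x \<prec> e \<longrightarrow> (\<exists>z\<in>C \<delta>. x \<prec> z \<and> z \<prec> e))"] by metis
    then have "?Q C (fst (E, D)) (snd (E, D))" using E by simp
    then show ?thesis by blast
  qed
  define F where "F C = (SOME p. ?Q C (fst p) (snd p))" for C
  have F: "?Q C (fst (F C)) (snd (F C))" if "club_sequence r \<mu> S C" for C
    using someI_ex[OF bad[OF that]] unfolding F_def .
  obtain C\<^sub>0 where C0: "club_sequence r \<mu> S C\<^sub>0"
    using club_seg_exists[OF ob' cof] bchoice[of S "\<lambda>\<delta> C. club (seg r \<delta>) C \<and> Restr r C =o \<mu>"]
    unfolding club_sequence_def by blast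
  \<comment> \<open>\<open>F C\<close> pairs a club of \<open>r\<close> with clubs \<open>D \<delta>\<close>: the former misses the gaps that start in \<open>C \<delta> \<inter> D \<delta>\<close>.\<close>
  define Cs where "Cs = rec_nat C\<^sub>0 (\<lambda>_ C \<delta>. C \<delta> \<inter> snd (F C) \<delta>)"
  have Cs0: "Cs 0 = C\<^sub>0" and CsSuc: "Cs (Suc n) \<delta> = Cs n \<delta> \<inter> snd (F (Cs n)) \<delta>" for n \<delta>
    by (simp_all add: Cs_def)
  have cs: "club_sequence r \<mu> S (Cs n)" for n
  proof (induction n)
    case 0 show ?case using C0 Cs0 by simp
  next
    case (Suc n)
    have "club (seg r \<delta>) (Cs (Suc n) \<delta>) \<and> Restr r (Cs (Suc n) \<delta>) =o \<mu>" if \<delta>: "\<delta> \<in> S" for \<delta>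
    proof -
      have n: "club (seg r \<delta>) (Cs n \<delta>)" "Restr r (Cs n \<delta>) =o \<mu>"
        using Suc \<delta> unfolding club_sequence_def by blast+
      have "club (seg r \<delta>) (Cs (Suc n) \<delta>)"
        unfolding CsSuc using club_seg_Int[OF ob'[OF \<delta>] n(1)] F[OF Suc] \<delta> by blast
      then show ?thesis using club_seg_subset_type[OF cof[OF \<delta>] n] CsSuc by blast
    qed
    then show ?case unfolding club_sequence_def by blast
  qed
  define E where "E = (\<Inter>n. fst (F (Cs n)))"
  have E: "club r E" unfolding E_def by (rule club_INT[OF ob]) (use F[OF cs] in blast)
  \<comment> \<open>A point of \<open>S\<close> that is a limit of the set \<open>S\<^sub>1\<close> leads to the contradiction.\<close>
  define S\<^sub>1 where "S\<^sub>1 = S \<inter> limits r E"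
  have "club r (limits r E)" using club_limits[OF ob] E club_iff by blast
  then have "stationary r S\<^sub>1" unfolding S\<^sub>1_def using stationary_Int_club[OF ob stat] by blast
  then have "unbounded r S\<^sub>1" using stationary_unbounded omega_bounded_no_max[OF ob] by blast
  then have "club r (limits r S\<^sub>1)" using club_limits[OF ob] by blast
  then obtain \<delta> where \<delta>: "\<delta> \<in> S" "\<delta> \<in> limits r S\<^sub>1" using stat unfolding stationary_def by blast
  have Cd: "club (seg r \<delta>) (Cs n \<delta>)" for n using cs \<delta>(1) unfolding club_sequence_def by blast
  have Cd_sub: "Cs n \<delta> \<subseteq> underS \<delta>" for n
    using Cd unfolding club_seg_iff unbounded_seg_iff by blast
  have unb: "unbounded (seg r \<delta>) (\<Inter>n. Cs n \<delta>)"
    using club_seg_INT[of \<delta> "\<lambda>n. Cs n \<delta>", OF ob'[OF \<delta>(1)] Cd] unfolding club_seg_iff by blast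
  obtain a where "a \<prec> \<delta>" using \<delta>(2) unfolding limits_def by blast
  with unb have "(\<Inter>n. Cs n \<delta>) \<noteq> {}" unfolding unbounded_seg_iff by (metis empty_iff)
  then obtain a\<^sub>0 where "a\<^sub>0 \<in> (\<Inter>n. Cs n \<delta>)" unfolding ex_in_conv[symmetric] ..
  then have a0: "a\<^sub>0 \<in> Cs n \<delta>" for n by auto
  have a0d: "a\<^sub>0 \<prec> \<delta>" using a0[of 0] Cd_sub[of 0] by auto
  \<comment> \<open>From \<open>a\<^sub>0\<close> on, \<open>E\<close> is contained in \<open>Cs 0 \<delta>\<close>.\<close>
  have E_sub: "e \<in> Cs 0 \<delta>" if e: "e \<in> E" "a\<^sub>0 \<preceq> e" "e \<prec> \<delta>" for e
  proof -
    have ex: "\<exists>y. last_upto r (Cs n \<delta>) e y" for n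
    proof (rule last_upto_exists[OF _ a0 e(2)])
      show "Cs n \<delta> \<subseteq> Field r" using Cd_sub less_Field by blast
      show "\<beta> \<in> Cs n \<delta>" if "\<beta> \<in> limits r (Cs n \<delta>)" "\<beta> \<preceq> e" for \<beta>
        using Cd[of n] that le_less_trans[OF _ e(3)] unfolding club_seg_iff by blast
    qed
    define \<gamma> where "\<gamma> n = (SOME y. last_upto r (Cs n \<delta>) e y)" for n
    have \<gamma>: "last_upto r (Cs n \<delta>) e (\<gamma> n)" for n
      using someI_ex[OF ex[of n]] unfolding \<gamma>_def .
    have "\<gamma> (Suc n) \<preceq> \<gamma> n" for n
      using \<gamma>[of n] \<gamma>[of "Suc n"] CsSuc unfolding last_upto_def by blast
    then obtain N where N: "\<gamma> (Suc N) = \<gamma> N" using decreasing_stabilizes[of \<gamma>] by (meson le_SucI order_refl)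
    \<comment> \<open>A stable value below \<open>e\<close> would lie in the club on which \<open>e\<close> cannot belong to the gap that follows.\<close>
    have "\<gamma> N = e"
    proof (rule ccontr)
      assume "\<gamma> N \<noteq> e"
      then have "\<gamma> N \<prec> e" using \<gamma>[of N] less_iff unfolding last_upto_def by blast
      moreover have "\<gamma> N \<in> Cs N \<delta> \<inter> snd (F (Cs N)) \<delta>"
        using \<gamma>[of "Suc N"] N CsSuc unfolding last_upto_def by auto
      moreover have "e \<in> fst (F (Cs N))" using e(1) unfolding E_def by blast
      ultimately obtain z where "z \<in> Cs N \<delta>" "\<gamma> N \<prec> z" "z \<prec> e"
        using F[OF cs[of N]] \<delta>(1) by blast
      then show False
        using \<gamma>[of N] less_imp_le le_less_trans less_irrefl unfolding last_upto_def by blast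
    qed
    then have "e \<in> Cs N \<delta>" using \<gamma>[of N] unfolding last_upto_def by simp
    moreover have "Cs N \<delta> \<subseteq> Cs 0 \<delta>"
      by (rule lift_Suc_antimono_le[of "\<lambda>n. Cs n \<delta>"]) (simp_all add: CsSuc)
    ultimately show ?thesis by blast
  qed
  obtain \<delta>\<^sub>1 where d1: "\<delta>\<^sub>1 \<in> S" "\<delta>\<^sub>1 \<in> limits r E" "a\<^sub>0 \<prec> \<delta>\<^sub>1" "\<delta>\<^sub>1 \<prec> \<delta>"
    using limitsD[OF \<delta>(2) a0d] unfolding S\<^sub>1_def by blast
  have "\<delta>\<^sub>1 \<in> E" using E d1(2) unfolding club_iff by blast
  then have "\<delta>\<^sub>1 \<in> Cs 0 \<delta>" using E_sub less_imp_le d1 by blast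
  then have lt: "Restr r (Cs 0 \<delta> \<inter> underS \<delta>\<^sub>1) <o Restr r (Cs 0 \<delta>)"
    using initial_part_ordLess Cd_sub[of 0] less_Field by blast
  have "\<exists>b\<in>Cs 0 \<delta> \<inter> underS \<delta>\<^sub>1. a \<preceq> b" if a: "a \<prec> \<delta>\<^sub>1" for a
  proof -
    have "a \<preceq> a\<^sub>0 \<or> a\<^sub>0 \<preceq> a" using TOTALS less_Field(1)[OF a] less_Field(1)[OF d1(3)] by blast
    then obtain b where b: "b \<prec> \<delta>\<^sub>1" "a \<preceq> b" "a\<^sub>0 \<preceq> b"
      using a d1(3) le_refl[OF less_Field(1)[OF a]] le_refl[OF less_Field(1)[OF d1(3)]] by metis
    obtain e where e: "e \<in> E" "b \<prec> e" "e \<prec> \<delta>\<^sub>1" using limitsD[OF d1(2) b(1)] by blast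
    have "a \<preceq> e" "a\<^sub>0 \<preceq> e" using b(2,3) less_imp_le[OF e(2)] le_trans by blast+
    then show ?thesis using E_sub[OF e(1) _ less_trans[OF e(3) d1(4)]] e(3) by blast
  qed
  then have "unbounded (seg r \<delta>\<^sub>1) (Cs 0 \<delta> \<inter> underS \<delta>\<^sub>1)" unfolding unbounded_seg_iff by blast
  then have "\<mu> \<le>o Restr (seg r \<delta>\<^sub>1) (Cs 0 \<delta> \<inter> underS \<delta>\<^sub>1)"
    using cof[OF d1(1)] unfolding has_cofinality_def by blast
  then have "\<mu> \<le>o Restr r (Cs 0 \<delta> \<inter> underS \<delta>\<^sub>1)"
    using Restr_seg[of "Cs 0 \<delta> \<inter> underS \<delta>\<^sub>1" \<delta>\<^sub>1] by simp
  moreover have "Restr r (Cs 0 \<delta>) =o \<mu>" using cs \<delta>(1) unfolding club_sequence_def by blast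
  ultimately have "Restr r (Cs 0 \<delta>) \<le>o Restr r (Cs 0 \<delta> \<inter> underS \<delta>\<^sub>1)"
    using ordIso_ordLeq_trans by blast
  then show False using lt not_ordLess_ordLeq by blast
qed

section \<open>Guessing next points\<close>

text \<open>
  The correction interleaves with \<open>C\<close>: if \<open>y\<close> is the last point up to \<open>c\<close> and \<open>y'\<close> is a later corrected point,
  then \<open>y \<le> c < y'\<close>. So limits of corrected points are limits of \<open>C\<close>, and choosing such a \<open>c\<close>
  for each \<open>y\<close> is strictly increasing.
\<close>

lemma last_points_club:
  assumes cof: "has_cofinality (seg r \<delta>) \<mu>" and E: "club r E" and \<delta>: "\<delta> \<in> limits r E"
    and C: "club (seg r \<delta>) C" and type: "Restr r C =o \<mu>"
  shows "club (seg r \<delta>) (last_points r E C)" and "Restr r (last_points r E C) =o \<mu>"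
proof -
  have Cd: "C \<subseteq> underS \<delta>" and CF: "C \<subseteq> Field r"
    using C less_Field unfolding club_seg_iff unbounded_seg_iff by blast+
  have EF: "E \<subseteq> Field r" and Ecl: "limits r E \<subseteq> E"
    using E unfolding club_iff unbounded_def by blast+
  let ?G = "last_points r E C"
  have Gd: "?G \<subseteq> underS \<delta>" and GE: "?G \<subseteq> E"
    using Cd le_less_trans unfolding last_points_def last_upto_def by blast+
  have "\<exists>y\<in>?G. a \<preceq> y" if a: "a \<prec> \<delta>" for a
  proof -
    obtain e where e: "e \<in> E" "a \<prec> e" "e \<prec> \<delta>" using limitsD[OF \<delta> a] by blast
    obtain c where c: "c \<in> C" "e \<preceq> c" using C e(3) unfolding club_seg_iff unbounded_seg_iff by blast
    obtain y where y: "last_upto r E c y" using last_upto_exists[OF EF e(1) c(2)] Ecl by blast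
    then have "a \<preceq> y" using e c(2) le_trans less_imp_le unfolding last_upto_def by blast
    then show ?thesis using y c(1) unfolding last_points_def by blast
  qed
  then have unb: "unbounded (seg r \<delta>) ?G" unfolding unbounded_seg_iff using Gd by blast
  \<comment> \<open>Between two points of \<open>?G\<close> lies the point of \<open>C\<close> that gave rise to the first of them.\<close>
  have between: "c \<prec> y'" if "last_upto r E c y" "c \<in> C" "y' \<in> ?G" "y \<prec> y'" for c y y'
  proof -
    have "\<not> y' \<preceq> c" using that GE le_less_trans less_irrefl unfolding last_upto_def by blast
    then show ?thesis using not_le less_Field that CF by blast
  qed
  have "\<beta> \<in> ?G" if \<beta>: "\<beta> \<in> limits r ?G" "\<beta> \<prec> \<delta>" for \<beta>
  proof -
    have "\<beta> \<in> E" using \<beta>(1) limits_mono[OF GE] Ecl by blast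
    have "\<beta> \<in> limits r C"
    proof -
      obtain x where "x \<prec> \<beta>" using \<beta>(1) unfolding limits_def by blast
      then show ?thesis
      proof (rule limitsI)
        fix a assume "a \<prec> \<beta>"
        then obtain y where y: "y \<in> ?G" "a \<prec> y" "y \<prec> \<beta>" using limitsD[OF \<beta>(1)] by blast
        obtain y' where y': "y' \<in> ?G" "y \<prec> y'" "y' \<prec> \<beta>" using limitsD[OF \<beta>(1) y(3)] by blast
        obtain c where c: "c \<in> C" "last_upto r E c y" using y(1) unfolding last_points_def by blast
        have "c \<prec> \<beta>" using between[OF c(2,1) y'(1,2)] y'(3) less_trans by blast
        moreover have "a \<prec> c" using c(2) y(2) less_le_trans unfolding last_upto_def by blast
        ultimately show "\<exists>b\<in>C. a \<prec> b \<and> b \<prec> \<beta>" using c(1) by blast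
      qed
    qed
    then have "\<beta> \<in> C" using C \<beta>(2) unfolding club_seg_iff by blast
    moreover have "last_upto r E \<beta> \<beta>"
      using \<open>\<beta> \<in> E\<close> EF le_refl unfolding last_upto_def by blast
    ultimately show ?thesis unfolding last_points_def by blast
  qed
  then show "club (seg r \<delta>) ?G" unfolding club_seg_iff using unb by blast
  obtain f where f: "\<And>y. y \<in> ?G \<Longrightarrow> f y \<in> C \<and> last_upto r E (f y) y"
    using bchoice[of ?G "\<lambda>y c. c \<in> C \<and> last_upto r E c y"] unfolding last_points_def by blast
  show "Restr r ?G =o \<mu>"
  proof (rule Restr_ordIso_cofinality[OF cof unb CF])
    show "Restr r C \<le>o \<mu>" using type ordIso_imp_ordLeq by blast
    show "f ` ?G \<subseteq> C" using f by blast
    fix x y assume xy: "x \<in> ?G" "y \<in> ?G" "x \<prec> y"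
    have "f x \<prec> y" using between f xy by blast
    then show "f x \<prec> f y" using f[OF xy(2)] less_le_trans unfolding last_upto_def by blast
  qed
qed

text \<open>
  Gap guessing makes \<open>last_points\<close> nontrivial at stationarily many \<open>x\<close>: after the correction to
  a club containing \<open>x\<close>, the point following \<open>x\<close> still lies inside the old gap of \<open>x\<close>. Without it the corrections
  could delete that point altogether, and the new next point could increase from one
  correction to the next instead of decreasing.
\<close>

lemma next_guessing:
  fixes \<mu> :: "'m rel"
  assumes "Card_order \<mu>" and "natLeq <o \<mu>" and ob: "omega_bounded r"
    and S: "S \<subseteq> cof_set r \<mu>" and stat: "stationary r S"
  shows "\<exists>C. club_sequence r \<mu> S C \<and> (\<forall>E. club r E \<longrightarrow>
    (\<exists>\<delta>\<in>S. stationary (seg r \<delta>) {x \<in> C \<delta>. \<exists>y\<in>E. next_in r (C \<delta>) x y}))"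
proof (rule ccontr)
  assume no: "\<not> ?thesis"
  have cof: "has_cofinality (seg r \<delta>) \<mu>" if "\<delta> \<in> S" for \<delta>
    using that S cof_setD by blast
  have ob': "omega_bounded (seg r \<delta>)" if "\<delta> \<in> S" for \<delta>
    using omega_bounded_seg assms(1,2) cof[OF that] by blast
  obtain C where C: "club_sequence r \<mu> S C" and gap: "\<And>E. club r E \<Longrightarrow>
      \<exists>\<delta>\<in>S. stationary (seg r \<delta>) {x \<in> C \<delta>. \<exists>e\<in>E. x \<prec> e \<and> (\<forall>z\<in>C \<delta>. x \<prec> z \<longrightarrow> e \<preceq> z)}"
    using gap_guessing[OF assms] by blast
  \<comment> \<open>At a \<open>\<delta>\<close> that is not a limit of \<open>E\<close> the correction may be bounded, so \<open>C \<delta>\<close> is kept.\<close>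
  define G where "G E \<delta> = (if \<delta> \<in> limits r E then last_points r E (C \<delta>) else C \<delta>)" for E \<delta>
  have G: "club_sequence r \<mu> S (G E)" if "club r E" for E
    using C last_points_club[OF cof that] unfolding club_sequence_def G_def by simp
  let ?Q = "\<lambda>E E'. club r E' \<and>
    (\<forall>\<delta>\<in>S. \<not> stationary (seg r \<delta>) {x \<in> G E \<delta>. \<exists>y\<in>E'. next_in r (G E \<delta>) x y})"
  have bad: "\<exists>E'. ?Q E E'" if "club r E" for E using no G[OF that] by blast
  define F where "F E = (SOME E'. ?Q E E')" for E
  have F: "?Q E (F E)" if "club r E" for E using someI_ex[OF bad[OF that]] unfolding F_def .
  define Es where "Es = rec_nat (Field r) (\<lambda>_ E. E \<inter> F E)"
  have Es0: "Es 0 = Field r" and EsSuc: "Es (Suc n) = Es n \<inter> F (Es n)" for n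
    by (simp_all add: Es_def)
  have Es: "club r (Es n)" for n
  proof (induction n)
    case 0 show ?case using club_Field Es0 by simp
  next
    case (Suc n) then show ?case unfolding EsSuc using club_Int[OF ob] F by blast
  qed
  define E where "E = (\<Inter>n. Es n)"
  have E: "club r E" unfolding E_def using club_INT[OF ob Es] .
  obtain \<delta> where \<delta>: "\<delta> \<in> S" and T: "stationary (seg r \<delta>)
      {x \<in> C \<delta>. \<exists>e\<in>E. x \<prec> e \<and> (\<forall>z\<in>C \<delta>. x \<prec> z \<longrightarrow> e \<preceq> z)}" (is "stationary _ ?T")
    using gap[OF E] by blast
  have T_meets: "?T \<inter> D \<noteq> {}" if "club (seg r \<delta>) D" for D
    using T that unfolding stationary_def by blast
  have Cd: "club (seg r \<delta>) (C \<delta>)" using C \<delta> unfolding club_sequence_def by blast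
  have Cd_sub: "C \<delta> \<subseteq> underS \<delta>" using Cd unfolding club_seg_iff unbounded_seg_iff by blast
  have nomax: "\<exists>b. a \<prec> b \<and> b \<prec> \<delta>" if a: "a \<prec> \<delta>" for a
  proof -
    interpret s: wo_rel "seg r \<delta>" using Well_order_seg by (simp add: wo_rel_def)
    obtain b where "s.less_ord a b"
      using s.omega_bounded_no_max[OF ob'[OF \<delta>]] a Field_seg by blast
    moreover have "b \<prec> \<delta>" using s.less_Field calculation Field_seg by blast
    ultimately show ?thesis using underS_seg by blast
  qed
  have Cnext: "\<exists>y. next_in r (C \<delta>) x y" if x: "x \<prec> \<delta>" for x
  proof -
    obtain b where "x \<prec> b" "b \<prec> \<delta>" using nomax[OF x] by blast
    then obtain c where "c \<in> C \<delta>" "x \<prec> c"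
      using Cd less_le_trans unfolding club_seg_iff unbounded_seg_iff by blast
    then show ?thesis
      using least_exists[of "{c \<in> C \<delta>. x \<prec> c}"] less_Field unfolding next_in_def by blast
  qed
  have "unbounded (seg r \<delta>) ?T"
  proof -
    interpret s: wo_rel "seg r \<delta>" using Well_order_seg by (simp add: wo_rel_def)
    show ?thesis using s.stationary_unbounded[OF s.omega_bounded_no_max[OF ob'[OF \<delta>]] T] .
  qed
  then have unb: "\<exists>x\<in>?T. a \<preceq> x" if "a \<prec> \<delta>" for a
    using that unfolding unbounded_seg_iff by blast
  \<comment> \<open>Gaps that meet \<open>E\<close> start above every point below \<open>\<delta>\<close>, and they end below \<open>\<delta>\<close>.\<close>
  have \<delta>E: "\<delta> \<in> limits r E"
  proof -
    have "?T \<noteq> {}" using T_meets[OF Cd] by blast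
    then obtain x where "x \<prec> \<delta>" using Cd_sub by blast
    then show ?thesis
    proof (rule limitsI)
      fix a assume a: "a \<prec> \<delta>"
      then obtain x e where x: "x \<in> C \<delta>" "a \<preceq> x" and e: "e \<in> E" "x \<prec> e" "\<And>z. z \<in> C \<delta> \<Longrightarrow> x \<prec> z \<Longrightarrow> e \<preceq> z"
        using unb[OF a] by blast
      obtain y where "y \<in> C \<delta>" "x \<prec> y" using Cnext x(1) Cd_sub unfolding next_in_def by blast
      then have "e \<prec> \<delta>" using e(3) Cd_sub le_less_trans by blast
      then show "\<exists>b\<in>E. a \<prec> b \<and> b \<prec> \<delta>" using e x(2) le_less_trans by blast
    qed
  qed
  then have \<delta>Es: "\<delta> \<in> limits r (Es n)" for n
    using limits_mono[of E "Es n"] unfolding E_def by blast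
  have "\<exists>D. club (seg r \<delta>) D \<and> (\<forall>x\<in>D \<inter> last_points r (Es n) (C \<delta>). \<forall>y\<in>F (Es n).
      \<not> next_in r (last_points r (Es n) (C \<delta>)) x y)" for n
  proof -
    have GC: "G (Es n) \<delta> = last_points r (Es n) (C \<delta>)" using \<delta>Es unfolding G_def by simp
    have "last_points r (Es n) (C \<delta>) \<subseteq> underS \<delta>"
      using Cd_sub le_less_trans unfolding last_points_def last_upto_def by blast
    then show ?thesis
      using F[OF Es[of n]] \<delta> unfolding stationary_def Field_seg GC[symmetric] by blast
  qed
  then obtain D where D: "\<And>n. club (seg r \<delta>) (D n)" "\<And>n x y. x \<in> D n \<Longrightarrow> x \<in> last_points r (Es n) (C \<delta>)
      \<Longrightarrow> y \<in> F (Es n) \<Longrightarrow> \<not> next_in r (last_points r (Es n) (C \<delta>)) x y"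
    by (metis IntI)
  let ?D = "(\<Inter>n. D n) \<inter> (E \<inter> underS \<delta>)"
  have "club (seg r \<delta>) ?D"
    using club_seg_Int[OF ob'[OF \<delta>] club_seg_INT[of \<delta> D, OF ob'[OF \<delta>] D(1)] club_Int_seg[OF E \<delta>E]] .
  then have "?T \<inter> ?D \<noteq> {}" by (rule T_meets)
  then obtain x where xTD: "x \<in> ?T \<inter> ?D" unfolding ex_in_conv[symmetric] ..
  have xT: "x \<in> ?T" using xTD by (rule IntD1)
  have xD: "x \<in> ?D" using xTD by (rule IntD2)
  have x: "x \<in> D n" "x \<in> E" "x \<in> C \<delta>" for n
    using xT xD by auto
  obtain e where e: "e \<in> E" "x \<prec> e" "\<And>z. z \<in> C \<delta> \<Longrightarrow> x \<prec> z \<Longrightarrow> e \<preceq> z"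
    using xT by auto
  obtain c where c: "next_in r (C \<delta>) x c" using Cnext x(3) Cd_sub by blast
  then have c': "c \<in> C \<delta>" "x \<prec> c" "e \<preceq> c" using e(3) unfolding next_in_def by blast+
  have ex: "\<exists>y. last_upto r (Es n) c y" for n
  proof (rule last_upto_exists[OF _ _ c'(3)])
    show "Es n \<subseteq> Field r" using Es[of n] unfolding club_iff unbounded_def by blast
    show "e \<in> Es n" using e(1) unfolding E_def by blast
    show "\<beta> \<in> Es n" if "\<beta> \<in> limits r (Es n)" for \<beta>
      using Es[of n] that unfolding club_iff by blast
  qed
  \<comment> \<open>\<open>y n\<close> is the next point after \<open>x\<close> in the correction to \<open>Es n\<close>.\<close>
  define y where "y n = (SOME y. last_upto r (Es n) c y)" for n
  have y: "last_upto r (Es n) c (y n)" for n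
    using someI_ex[OF ex[of n]] unfolding y_def .
  have "y (Suc n) \<preceq> y n" for n
    using y[of n] y[of "Suc n"] EsSuc unfolding last_upto_def by blast
  then obtain N where N: "y (Suc N) = y N" using decreasing_stabilizes[of y] by (meson le_SucI order_refl)
  have "y N \<in> F (Es N)" using y[of "Suc N"] N EsSuc unfolding last_upto_def by auto
  moreover have "x \<in> last_points r (Es N) (C \<delta>)"
  proof -
    have "x \<in> Es N" using x(2) unfolding E_def by blast
    then have "last_upto r (Es N) x x" using le_refl less_Field(1)[OF c'(2)] unfolding last_upto_def by blast
    then show ?thesis using x(3) unfolding last_points_def by blast
  qed
  moreover have "next_in r (last_points r (Es N) (C \<delta>)) x (y N)"
    unfolding next_in_def
  proof (intro conjI ballI impI)
    show "y N \<in> last_points r (Es N) (C \<delta>)" using y c'(1) unfolding last_points_def by blast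
    have "e \<in> Es N" using e(1) unfolding E_def by blast
    then show "x \<prec> y N" using y[of N] c'(3) e(2) less_le_trans unfolding last_upto_def by blast
    fix z assume "z \<in> last_points r (Es N) (C \<delta>)" and xz: "x \<prec> z"
    then obtain d where d: "d \<in> C \<delta>" "last_upto r (Es N) d z" unfolding last_points_def by blast
    then have "x \<prec> d" using xz less_le_trans unfolding last_upto_def by blast
    then have "c \<preceq> d" using c d(1) unfolding next_in_def by blast
    then show "y N \<preceq> z" using y[of N] d(2) le_trans unfolding last_upto_def by blast
  qed
  ultimately show False using D(2) x(1) by blast
qed

section \<open>Enumerations in order type \<open>\<mu>\<close>\<close>

lemma enumeration_strict_mono:
  assumes C: "C \<subseteq> Field r" and f: "iso \<mu> (Restr r C) f"
    and a: "a \<in> Field \<mu>" and b: "b \<in> Field \<mu>"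
  shows "f a \<prec> f b \<longleftrightarrow> a \<in> Order_Relation.underS \<mu> b"
proof -
  have F: "Field (Restr r C) = C" using Refl_Field_Restr2[OF REFL C] .
  have bij: "bij_betw f (Field \<mu>) C" and "(a, b) \<in> \<mu> \<longleftrightarrow> (f a, f b) \<in> Restr r C"
    using f a b unfolding iso_iff2 F by blast+
  moreover have "f a \<in> C" "f b \<in> C" using bij a b by (auto simp: bij_betw_def)
  moreover have "f a = f b \<longleftrightarrow> a = b" using bij a b by (auto simp: bij_betw_def inj_on_eq_iff)
  ultimately show ?thesis by (auto simp: underS_def)
qed

lemma enumeration_image: "C \<subseteq> Field r \<Longrightarrow> iso \<mu> (Restr r C) f \<Longrightarrow> f ` Field \<mu> = C"
  using Refl_Field_Restr2[OF REFL] unfolding iso_iff2 bij_betw_def by metis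

text \<open>
  Clubs transfer from \<open>\<mu>\<close> to \<open>\<delta>\<close> because \<open>C\<close> is closed: a limit below \<open>\<delta>\<close> of enumerated points is
  itself enumerated, at a limit index.
\<close>

lemma enumeration_club_image:
  assumes mu: "Well_order \<mu>" and C: "club (seg r \<delta>) C" and f: "iso \<mu> (Restr r C) f"
    and e: "club \<mu> e"
  shows "club (seg r \<delta>) (f ` e)"
proof -
  interpret m: wo_rel \<mu> using mu by (simp add: wo_rel_def)
  have Cd: "C \<subseteq> underS \<delta>" and CF: "C \<subseteq> Field r"
    using C less_Field unfolding club_seg_iff unbounded_seg_iff by blast+
  have eF: "e \<subseteq> Field \<mu>" and e_cl: "limits \<mu> e \<subseteq> e"
    and e_unb: "\<And>a. a \<in> Field \<mu> \<Longrightarrow> \<exists>b\<in>e. m.less_eq_ord a b"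
    using e unfolding m.club_iff unbounded_def by blast+
  have img: "f ` Field \<mu> = C" using enumeration_image[OF CF f] .
  have less: "f a \<prec> f b \<longleftrightarrow> m.less_ord a b" if "a \<in> Field \<mu>" "b \<in> Field \<mu>" for a b
    using enumeration_strict_mono[OF CF f that] .
  have "\<exists>b\<in>f ` e. a \<preceq> b" if a: "a \<prec> \<delta>" for a
  proof -
    obtain c where c: "c \<in> C" "a \<preceq> c" using C a unfolding club_seg_iff unbounded_seg_iff by blast
    then obtain \<zeta> where \<zeta>: "\<zeta> \<in> Field \<mu>" "c = f \<zeta>" using img by blast
    obtain \<eta> where \<eta>: "\<eta> \<in> e" "m.less_eq_ord \<zeta> \<eta>" using e_unb[OF \<zeta>(1)] by blast
    have "f \<zeta> \<preceq> f \<eta>" using iso_forward[OF \<eta>(2) f] by simp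
    then show ?thesis using c(2) \<zeta>(2) \<eta>(1) le_trans by blast
  qed
  moreover have "f ` e \<subseteq> underS \<delta>" using eF img Cd by blast
  moreover have "\<beta> \<in> f ` e" if \<beta>: "\<beta> \<in> limits r (f ` e)" "\<beta> \<prec> \<delta>" for \<beta>
  proof -
    have "f ` e \<subseteq> C" using eF img by blast
    then have "\<beta> \<in> C" using C \<beta> limits_mono unfolding club_seg_iff by blast
    then obtain \<zeta> where \<zeta>: "\<zeta> \<in> Field \<mu>" "\<beta> = f \<zeta>" using img by blast
    have between: "\<exists>\<eta>\<in>e. a \<prec> f \<eta> \<and> m.less_ord \<eta> \<zeta>" if a: "a \<prec> \<beta>" for a
    proof -
      obtain \<eta> where "\<eta> \<in> e" "a \<prec> f \<eta>" "f \<eta> \<prec> f \<zeta>" using limitsD[OF \<beta>(1) a] \<zeta>(2) by blast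
      then show ?thesis using less[of \<eta> \<zeta>] eF \<zeta>(1) by blast
    qed
    obtain x where "x \<prec> \<beta>" using \<beta>(1) unfolding limits_def by blast
    then obtain \<eta>\<^sub>0 where "m.less_ord \<eta>\<^sub>0 \<zeta>" using between by blast
    then have "\<zeta> \<in> limits \<mu> e"
    proof (rule m.limitsI)
      fix \<xi> assume \<xi>: "m.less_ord \<xi> \<zeta>"
      have \<xi>F: "\<xi> \<in> Field \<mu>" using m.less_Field(1)[OF \<xi>] .
      have "f \<xi> \<prec> \<beta>" using less[OF \<xi>F \<zeta>(1)] \<xi> \<zeta>(2) by simp
      then obtain \<eta> where "\<eta> \<in> e" "f \<xi> \<prec> f \<eta>" "m.less_ord \<eta> \<zeta>" using between by blast
      then show "\<exists>b\<in>e. m.less_ord \<xi> b \<and> m.less_ord b \<zeta>" using less[OF \<xi>F] eF by blast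
    qed
    then show ?thesis using e_cl \<zeta>(2) by blast
  qed
  ultimately show ?thesis unfolding club_seg_iff unbounded_seg_iff by blast
qed

lemma enumeration_next:
  assumes mu: "Well_order \<mu>" and nomax: "\<And>\<zeta>. \<zeta> \<in> Field \<mu> \<Longrightarrow> \<exists>\<eta>. \<zeta> \<in> Order_Relation.underS \<mu> \<eta>"
    and C: "C \<subseteq> Field r" and f: "iso \<mu> (Restr r C) f" and \<zeta>: "\<zeta> \<in> Field \<mu>"
  shows "next_in r C (f \<zeta>) (f (next_ord \<mu> \<zeta>))"
proof -
  interpret m: wo_rel \<mu> using mu by (simp add: wo_rel_def)
  have above: "\<eta> \<in> m.AboveS {\<zeta>} \<longleftrightarrow> m.less_ord \<zeta> \<eta>" for \<eta>
    using m.less_Field(2) by (auto simp: AboveS_def underS_def Field_def)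
  let ?n = "m.suc {\<zeta>}"
  have n: "m.less_ord \<zeta> ?n"
    using m.suc_AboveS[of "{\<zeta>}"] \<zeta> nomax[OF \<zeta>] above by blast
  then have nF: "?n \<in> Field \<mu>" by (rule m.less_Field(2))
  have img: "f ` Field \<mu> = C" using enumeration_image[OF C f] .
  show ?thesis unfolding next_in_def
  proof (intro conjI ballI impI)
    show "f ?n \<in> C" using img nF by blast
    show "f \<zeta> \<prec> f ?n" using enumeration_strict_mono[OF C f \<zeta> nF] n by simp
    fix z assume z: "z \<in> C" "f \<zeta> \<prec> z"
    then obtain \<eta> where \<eta>: "\<eta> \<in> Field \<mu>" "z = f \<eta>" using img by blast
    then have "m.less_ord \<zeta> \<eta>" using enumeration_strict_mono[OF C f \<zeta> \<eta>(1)] z(2) by simp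
    then have "m.less_eq_ord ?n \<eta>" using m.suc_least_AboveS above by blast
    then show "f ?n \<preceq> z" using iso_forward[OF _ f] \<eta>(2) by blast
  qed
qed

lemma next_in_unique: "next_in r C x y \<Longrightarrow> next_in r C x z \<Longrightarrow> y = z"
  unfolding next_in_def using le_antisym by blast

lemma stationary_indices:
  assumes mu: "Well_order \<mu>" and nomax: "\<And>\<zeta>. \<zeta> \<in> Field \<mu> \<Longrightarrow> \<exists>\<eta>. \<zeta> \<in> Order_Relation.underS \<mu> \<eta>"
    and C: "club (seg r \<delta>) C" and f: "iso \<mu> (Restr r C) f"
    and stat: "stationary (seg r \<delta>) {x \<in> C. \<exists>y\<in>E. next_in r C x y}"
  shows "stationary \<mu> {\<zeta> \<in> Field \<mu>. f (next_ord \<mu> \<zeta>) \<in> E}"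
  unfolding stationary_def
proof (intro conjI allI impI)
  have CF: "C \<subseteq> Field r" using C less_Field unfolding club_seg_iff unbounded_seg_iff by blast
  fix e assume e: "club \<mu> e"
  have "club (seg r \<delta>) (f ` e)" using enumeration_club_image[OF mu C f e] .
  then obtain \<zeta> y where \<zeta>: "\<zeta> \<in> e" and y: "y \<in> E" "next_in r C (f \<zeta>) y"
    using stat unfolding stationary_def by blast
  have \<zeta>F: "\<zeta> \<in> Field \<mu>" using e \<zeta> unfolding club_def unbounded_def by blast
  have "f (next_ord \<mu> \<zeta>) = y"
    using next_in_unique[OF enumeration_next[OF mu nomax CF f \<zeta>F] y(2)] by blast
  then show "{\<zeta> \<in> Field \<mu>. f (next_ord \<mu> \<zeta>) \<in> E} \<inter> e \<noteq> {}" using \<zeta> \<zeta>F y(1) by blast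
qed blast

text \<open>
  A stationary set of indices is unbounded in \<open>\<mu>\<close>, so the points of \<open>E\<close> that it enumerates are
  unbounded in \<open>\<delta>\<close>.
\<close>

lemma limits_of_stationary_indices:
  assumes mu: "Well_order \<mu>" and nomax: "\<And>\<zeta>. \<zeta> \<in> Field \<mu> \<Longrightarrow> \<exists>\<eta>. \<zeta> \<in> Order_Relation.underS \<mu> \<eta>"
    and C: "club (seg r \<delta>) C" and f: "iso \<mu> (Restr r C) f" and ne: "C \<noteq> {}"
    and stat: "stationary \<mu> {\<zeta> \<in> Field \<mu>. f (next_ord \<mu> \<zeta>) \<in> E}"
  shows "\<delta> \<in> limits r E"
proof -
  interpret m: wo_rel \<mu> using mu by (simp add: wo_rel_def)
  have Cd: "C \<subseteq> underS \<delta>" and CF: "C \<subseteq> Field r"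
    using C less_Field unfolding club_seg_iff unbounded_seg_iff by blast+
  have unb: "unbounded \<mu> {\<zeta> \<in> Field \<mu>. f (next_ord \<mu> \<zeta>) \<in> E}"
    using m.stationary_unbounded[OF nomax stat] by blast
  obtain x where "x \<prec> \<delta>" using ne Cd by blast
  then show ?thesis
  proof (rule limitsI)
    fix a assume a: "a \<prec> \<delta>"
    obtain c where c: "c \<in> C" "a \<preceq> c" using C a unfolding club_seg_iff unbounded_seg_iff by blast
    then obtain \<eta> where \<eta>: "\<eta> \<in> Field \<mu>" "c = f \<eta>" using enumeration_image[OF CF f] by blast
    obtain \<zeta> where \<zeta>: "\<zeta> \<in> Field \<mu>" "f (next_ord \<mu> \<zeta>) \<in> E" "m.less_eq_ord \<eta> \<zeta>"
      using unb \<eta>(1) unfolding unbounded_def by blast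
    have "c \<preceq> f \<zeta>" using iso_forward[OF \<zeta>(3) f] \<eta>(2) by blast
    moreover have "f \<zeta> \<prec> f (next_ord \<mu> \<zeta>)" "f (next_ord \<mu> \<zeta>) \<in> C"
      using enumeration_next[OF mu nomax CF f \<zeta>(1)] unfolding next_in_def by blast+
    ultimately have "a \<prec> f (next_ord \<mu> \<zeta>)" "f (next_ord \<mu> \<zeta>) \<prec> \<delta>"
      using c(2) le_trans le_less_trans Cd by blast+
    then show "\<exists>b\<in>E. a \<prec> b \<and> b \<prec> \<delta>" using \<zeta>(2) by blast
  qed
qed

end

section \<open>The successor of an uncountable cardinal\<close>

text \<open>
  An unbounded sequence would cover \<open>\<mu>\<^sup>+\<close> by countably many sets of size at most \<open>\<mu>\<close>.
\<close>

lemma omega_bounded_successor_cardinal: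
  fixes \<mu> :: "'m rel" and r :: "'a rel"
  assumes mu: "Card_order \<mu>" "natLeq <o \<mu>" and lam: "Card_order r" "r =o cardSuc \<mu>"
  shows "omega_bounded r"
  unfolding omega_bounded_def
proof (intro allI impI, rule ccontr)
  fix x :: "nat \<Rightarrow> 'a" assume xF: "\<forall>n. x n \<in> Field r"
    and nb: "\<not> (\<exists>b\<in>Field r. \<forall>n. x n \<in> underS r b)"
  interpret wo_rel r using lam(1) card_order_on_well_order_on by (auto simp: wo_rel_def)
  have mu_lam: "\<mu> <o r"
    using cardSuc_greater[OF mu(1)] ordLess_ordIso_trans ordIso_symmetric[OF lam(2)] by blast
  have inf_mu: "\<not> finite (Field \<mu>)"
    using mu infinite_iff_natLeq_ordLeq[of "Field \<mu>"] ordLess_imp_ordLeq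
      card_of_Field_ordIso[OF mu(1)] ordIso_symmetric ordLeq_ordIso_trans by blast
  have inf: "\<not> finite (Field r)"
    using inf_mu card_of_mono2[OF ordLess_imp_ordLeq[OF mu_lam]] card_of_ordLeq_finite by blast
  have "Field r \<subseteq> (\<Union>n. underS (x n))"
  proof
    fix a assume a: "a \<in> Field r"
    obtain b where b: "b \<in> Field r" "a \<prec> b"
      using infinite_Card_order_limit[OF lam(1) inf a] less_iff by blast
    then obtain n where "\<not> x n \<prec> b" using nb by blast
    then have "b \<preceq> x n" using not_less b(1) xF by blast
    then show "a \<in> (\<Union>n. underS (x n))" using b(2) less_le_trans by blast
  qed
  moreover have "|\<Union>n\<in>(UNIV::nat set). underS (x n)| \<le>o \<mu>"
  proof (rule card_of_UNION_ordLeq_infinite_Field[OF inf_mu mu(1)])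
    show "|UNIV :: nat set| \<le>o \<mu>"
      using card_of_nat ordIso_ordLeq_trans ordLess_imp_ordLeq[OF mu(2)] by blast
    have "|underS (x n)| <o cardSuc \<mu>" for n
      using card_of_underS[OF lam(1)] xF lam(2) ordLess_ordIso_trans by blast
    then show "\<forall>n\<in>UNIV. |underS (x n)| \<le>o \<mu>"
      using cardSuc_ordLeq_ordLess[OF mu(1) card_of_Card_order] by blast
  qed
  ultimately have "|Field r| \<le>o \<mu>" using card_of_mono1 ordLeq_transitive by blast
  then have "r \<le>o \<mu>"
    using card_of_Field_ordIso[OF lam(1)] ordIso_symmetric ordIso_ordLeq_trans by blast
  then show False using mu_lam not_ordLess_ordLeq by blast
qed

theorem theorem2p1:
  fixes \<mu> :: "'m rel" and lambda :: "'l rel" and S :: "'l set"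
  assumes "Card_order \<mu>" and "natLeq <o \<mu>" and "regularCard \<mu>"
    and "Card_order lambda" and "lambda =o cardSuc \<mu>"
    and "S \<subseteq> cof_set lambda \<mu>" and "stationary lambda S"
  shows "(\<exists>C \<alpha>. club_sequence lambda \<mu> S C \<and> enumerations lambda \<mu> S C \<alpha> \<and>
            (\<forall>E. club lambda E \<longrightarrow>
               (\<exists>\<delta>\<in>S. stationary \<mu> {\<zeta> \<in> Field \<mu>. \<alpha> \<delta> (next_ord \<mu> \<zeta>) \<in> E}))) \<and>
         (\<forall>C \<alpha>. club_sequence lambda \<mu> S C \<and> enumerations lambda \<mu> S C \<alpha> \<longrightarrow>
            (\<forall>E. club lambda E \<longrightarrow>
               (\<exists>\<delta>\<in>S. stationary \<mu> {\<zeta> \<in> Field \<mu>. \<alpha> \<delta> (next_ord \<mu> \<zeta>) \<in> E})) \<longleftrightarrow>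
            (\<forall>E. club lambda E \<longrightarrow>
               stationary lambda
                 {\<delta> \<in> S. stationary \<mu> {\<zeta> \<in> Field \<mu>. \<alpha> \<delta> (next_ord \<mu> \<zeta>) \<in> E}}))"
proof -
  have wo: "Well_order \<mu>" "Well_order lambda"
    using assms(1,4) card_order_on_well_order_on by blast+
  interpret wo_rel lambda using wo(2) by (simp add: wo_rel_def)
  interpret m: wo_rel \<mu> using wo(1) by (simp add: wo_rel_def)
  have ob: "omega_bounded lambda"
    using omega_bounded_successor_cardinal assms(1,2,4,5) by blast
  have inf: "\<not> finite (Field \<mu>)"
    using assms(1,2) infinite_iff_natLeq_ordLeq[of "Field \<mu>"] ordLess_imp_ordLeq
      card_of_Field_ordIso ordIso_symmetric ordLeq_ordIso_trans by blast
  have nomax: "\<exists>\<eta>. m.less_ord \<zeta> \<eta>" if "\<zeta> \<in> Field \<mu>" for \<zeta>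
    using infinite_Card_order_limit[OF assms(1) inf that] m.less_iff by blast
  show ?thesis
  proof (intro conjI allI impI)
    obtain C where C: "club_sequence lambda \<mu> S C" and guess: "\<And>E. club lambda E \<Longrightarrow>
        \<exists>\<delta>\<in>S. stationary (seg lambda \<delta>) {x \<in> C \<delta>. \<exists>y\<in>E. next_in lambda (C \<delta>) x y}"
      using next_guessing[OF assms(1,2) ob assms(6,7)] by blast
    have "\<forall>\<delta>\<in>S. \<exists>f. iso \<mu> (Restr lambda (C \<delta>)) f"
      using C ordIso_symmetric unfolding club_sequence_def ordIso_def by blast
    then obtain \<alpha> where \<alpha>: "\<forall>\<delta>\<in>S. iso \<mu> (Restr lambda (C \<delta>)) (\<alpha> \<delta>)"
      using bchoice by metis
    have "\<exists>\<delta>\<in>S. stationary \<mu> {\<zeta> \<in> Field \<mu>. \<alpha> \<delta> (next_ord \<mu> \<zeta>) \<in> E}"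
      if E: "club lambda E" for E
    proof -
      obtain \<delta> where \<delta>: "\<delta> \<in> S"
        "stationary (seg lambda \<delta>) {x \<in> C \<delta>. \<exists>y\<in>E. next_in lambda (C \<delta>) x y}"
        using guess[OF E] by blast
      have "club (seg lambda \<delta>) (C \<delta>)" using C \<delta>(1) unfolding club_sequence_def by blast
      then show ?thesis using stationary_indices[OF wo(1) nomax _ _ \<delta>(2)] \<alpha> \<delta>(1) by blast
    qed
    then show "\<exists>C \<alpha>. club_sequence lambda \<mu> S C \<and> enumerations lambda \<mu> S C \<alpha> \<and>
        (\<forall>E. club lambda E \<longrightarrow>
          (\<exists>\<delta>\<in>S. stationary \<mu> {\<zeta> \<in> Field \<mu>. \<alpha> \<delta> (next_ord \<mu> \<zeta>) \<in> E}))"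
      using C \<alpha> unfolding enumerations_def by blast
  next
    fix C \<alpha> assume *: "club_sequence lambda \<mu> S C \<and> enumerations lambda \<mu> S C \<alpha>"
    let ?I = "\<lambda>E \<delta>. {\<zeta> \<in> Field \<mu>. \<alpha> \<delta> (next_ord \<mu> \<zeta>) \<in> E}"
    show "(\<forall>E. club lambda E \<longrightarrow> (\<exists>\<delta>\<in>S. stationary \<mu> (?I E \<delta>))) \<longleftrightarrow>
        (\<forall>E. club lambda E \<longrightarrow> stationary lambda {\<delta> \<in> S. stationary \<mu> (?I E \<delta>)})"
    proof (intro iffI allI impI)
      fix E assume guess: "\<forall>E. club lambda E \<longrightarrow> (\<exists>\<delta>\<in>S. stationary \<mu> (?I E \<delta>))"
        and E: "club lambda E"
      show "stationary lambda {\<delta> \<in> S. stationary \<mu> (?I E \<delta>)}"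
        unfolding stationary_def[of lambda]
      proof (intro conjI allI impI)
        show "{\<delta> \<in> S. stationary \<mu> (?I E \<delta>)} \<subseteq> Field lambda"
          using assms(6) cof_setD by blast
        fix E' assume E': "club lambda E'"
        obtain \<delta> where \<delta>: "\<delta> \<in> S" and stat: "stationary \<mu> (?I (E \<inter> E') \<delta>)"
          using guess club_Int[OF ob E E'] by blast
        have C: "club (seg lambda \<delta>) (C \<delta>)" and f: "iso \<mu> (Restr lambda (C \<delta>)) (\<alpha> \<delta>)"
          using * \<delta> unfolding club_sequence_def enumerations_def by blast+
        have "C \<delta> \<noteq> {}"
        proof -
          have "C \<delta> \<subseteq> Field lambda"
            using C less_Field unfolding club_seg_iff unbounded_seg_iff by blast
          then show ?thesis using enumeration_image[OF _ f] inf by auto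
        qed
        then have "\<delta> \<in> limits lambda (E \<inter> E')"
          using limits_of_stationary_indices[OF wo(1) nomax C f _ stat] by blast
        then have "\<delta> \<in> E'"
          using limits_mono[of "E \<inter> E'" E'] E' unfolding club_iff by blast
        moreover have "stationary \<mu> (?I E \<delta>)"
          using stat unfolding stationary_def by blast
        ultimately show "{\<delta> \<in> S. stationary \<mu> (?I E \<delta>)} \<inter> E' \<noteq> {}" using \<delta> by blast
      qed
    next
      fix E assume "\<forall>E. club lambda E \<longrightarrow> stationary lambda {\<delta> \<in> S. stationary \<mu> (?I E \<delta>)}"
        and "club lambda E"
      then show "\<exists>\<delta>\<in>S. stationary \<mu> (?I E \<delta>)"
        using club_Field unfolding stationary_def[of lambda] by blast
    qed
  qed
qed

end
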